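(* Let $G$ be a finite group and $F$ a field of characteristic $0$ or of characteristic prime to the order of $G$. Then the number of mutually inequivalent irreducible $F$-representations of $G$ is equal to the number of $F$-conjugacy classes of elements of $G$.
   Context: Representations are finite-dimensional. Two elements $x,y\in G$ are called $F$-conjugate, written $x\sim_F y$, if $\chi_\rho(x)=\chi_\rho(y)$ for every finite-dimensional $F$-representation $\rho$ of $G$, where $\chi_\rho$ (with values in $F$) is the character (trace function) of $\rho$. This is an equivalence relation on $G$; its classes are the $F$-conjugacy classes. *)

theory Defs
  imports "Jordan_Normal_Form.VS_Connect"
begin

text \<open>Finite-dimensional representations are matrix representations: homomorphisms into
  the unit group of the ring of \<open>n \<times> n\<close> matrices, acting on column vectors.\<close>

definition representation :: "('g, 'b) monoid_scheme \<Rightarrow> nat \<Rightarrow> ('g \<Rightarrow> 'f::field mat) \<Rightarrow> bool" where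
  "representation G n \<rho> \<longleftrightarrow> \<rho> \<in> hom G (units_of (ring_mat TYPE('f) n ()))"

definition character :: "('g \<Rightarrow> 'f::field mat) \<Rightarrow> 'g \<Rightarrow> 'f" where
  "character \<rho> g = sum_list (diag_mat (\<rho> g))"

definition irreducible_representation ::
    "('g, 'b) monoid_scheme \<Rightarrow> nat \<Rightarrow> ('g \<Rightarrow> 'f::field mat) \<Rightarrow> bool" where
  "irreducible_representation G n \<rho> \<longleftrightarrow>
     representation G n \<rho> \<and> 0 < n \<and>
     (\<forall>W. VectorSpace.subspace class_ring W (module_vec TYPE('f) n) \<and>
          (\<forall>g\<in>carrier G. \<forall>v\<in>W. \<rho> g *\<^sub>v v \<in> W) \<longrightarrow>
          W = {0\<^sub>v n} \<or> W = carrier_vec n)"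

text \<open>The degree is determined by \<open>\<rho>\<close> as the dimension of \<open>\<rho> \<one>\<close>.\<close>

definition irreducibles :: "('g, 'b) monoid_scheme \<Rightarrow> ('g \<Rightarrow> 'f::field mat) set" where
  "irreducibles G = {\<rho>. \<exists>n. irreducible_representation G n \<rho>}"

text \<open>The same pair \<open>P\<close>, \<open>Q\<close> of mutually inverse matrices has to work for all \<open>g\<close>. Values
  outside the carrier are ignored, so functions that agree on the carrier are identified.\<close>

definition equivalent_representations ::
    "('g, 'b) monoid_scheme \<Rightarrow> ('g \<Rightarrow> 'f::field mat) \<Rightarrow> ('g \<Rightarrow> 'f mat) \<Rightarrow> bool" where
  "equivalent_representations G \<rho> \<sigma> \<longleftrightarrow>
     (\<exists>P Q. \<forall>g\<in>carrier G. similar_mat_wit (\<rho> g) (\<sigma> g) P Q)"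

definition irreducible_equivalence ::
    "('g, 'b) monoid_scheme \<Rightarrow> (('g \<Rightarrow> 'f::field mat) \<times> ('g \<Rightarrow> 'f mat)) set" where
  "irreducible_equivalence G =
     {(\<rho>, \<sigma>). \<rho> \<in> irreducibles G \<and> \<sigma> \<in> irreducibles G \<and> equivalent_representations G \<rho> \<sigma>}"

definition F_conjugate :: "'f::field itself \<Rightarrow> ('g, 'b) monoid_scheme \<Rightarrow> 'g \<Rightarrow> 'g \<Rightarrow> bool" where
  "F_conjugate F G x y \<longleftrightarrow>
     (\<forall>n (\<rho> :: 'g \<Rightarrow> 'f mat). representation G n \<rho> \<longrightarrow> character \<rho> x = character \<rho> y)"

definition F_conjugacy :: "'f::field itself \<Rightarrow> ('g, 'b) monoid_scheme \<Rightarrow> ('g \<times> 'g) set" where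
  "F_conjugacy F G = {(x, y). x \<in> carrier G \<and> y \<in> carrier G \<and> F_conjugate F G x y}"

lemma equiv_F_conjugacy: "equiv (carrier G) (F_conjugacy F G)"
  by (rule equivI) (auto simp: F_conjugacy_def F_conjugate_def refl_on_def sym_def trans_def)

lemma representation_carrier_mat:
  assumes "representation G n \<rho>" "g \<in> carrier G"
  shows "\<rho> g \<in> carrier_mat n n"
  using assms by (auto simp: representation_def hom_def units_of_def Units_def ring_mat_def)

lemma equiv_irreducible_equivalence:
  "equiv (irreducibles G) (irreducible_equivalence G :: (('g \<Rightarrow> 'f::field mat) \<times> _) set)"
proof (rule equivI)
  have "equivalent_representations G \<rho> \<rho>" if "\<rho> \<in> irreducibles G" for \<rho> :: "'g \<Rightarrow> 'f mat"
  proof -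
    from that obtain n where n: "representation G n \<rho>"
      by (auto simp: irreducibles_def irreducible_representation_def)
    have "\<forall>g\<in>carrier G. similar_mat_wit (\<rho> g) (\<rho> g) (1\<^sub>m n) (1\<^sub>m n)"
      using representation_carrier_mat[OF n] similar_mat_wit_refl by blast
    then show ?thesis
      unfolding equivalent_representations_def by blast
  qed
  then show "refl_on (irreducibles G) (irreducible_equivalence G :: (('g \<Rightarrow> 'f mat) \<times> _) set)"
    by (auto simp: refl_on_def irreducible_equivalence_def)
  show "sym (irreducible_equivalence G :: (('g \<Rightarrow> 'f mat) \<times> _) set)"
    unfolding sym_def irreducible_equivalence_def equivalent_representations_def
    using similar_mat_wit_sym by blast
  show "trans (irreducible_equivalence G :: (('g \<Rightarrow> 'f mat) \<times> _) set)"
    unfolding trans_def irreducible_equivalence_def equivalent_representations_def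
    using similar_mat_wit_trans by blast
qed (auto simp: irreducible_equivalence_def)

end

theory Submission
  imports Defs "HOL-Library.Function_Algebras"
begin

text \<open>To an irreducible \<open>\<rho>\<close> with character \<open>\<chi>\<close> attach the linear functional
  \<open>\<phi>(f) = \<Sum>g. \<rho>(g\<^sup>-\<^sup>1)\<^bsub>00\<^esub> f(g)\<close>. By Schur's lemma \<open>\<phi>\<close> kills the irreducible characters
  not equivalent to \<open>\<chi>\<close>. It maps the regular character, which is a sum of irreducible ones, to
  \<open>|G| \<noteq> 0\<close>, so \<open>\<phi>(\<chi>) \<noteq> 0\<close>: the characters of inequivalent irreducibles are distinct and
  linearly independent.

  Conversely, composition series and tensor products make the span of the irreducible characters an
  algebra of functions. It contains the constants and separates the \<open>F\<close>-classes, and is therefore, as in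
  the Stone--Weierstrass theorem, the space of all functions constant on \<open>F\<close>-classes.\<close>

section \<open>Traces and matrix representations\<close>

lemma sum_list_diag_mat:
  "A \<in> carrier_mat n m \<Longrightarrow> sum_list (diag_mat A) = (\<Sum>i<n. A $$ (i, i))"
  by (simp add: diag_mat_def interv_sum_list_conv_sum_set_nat atLeast0LessThan)

lemma trace_mult_comm:
  fixes A B :: "'f::comm_semiring_0 mat"
  assumes "A \<in> carrier_mat n m" "B \<in> carrier_mat m n"
  shows "sum_list (diag_mat (A * B)) = sum_list (diag_mat (B * A))"
proof -
  have "sum_list (diag_mat (A * B)) = (\<Sum>i<n. \<Sum>j<m. A $$ (i, j) * B $$ (j, i))"
    using assms by (simp add: diag_mat_def interv_sum_list_conv_sum_set_nat scalar_prod_def atLeast0LessThan)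
  also have "\<dots> = (\<Sum>j<m. \<Sum>i<n. B $$ (j, i) * A $$ (i, j))"
    by (subst sum.swap) (simp add: mult.commute)
  also have "\<dots> = sum_list (diag_mat (B * A))"
    using assms by (simp add: diag_mat_def interv_sum_list_conv_sum_set_nat scalar_prod_def atLeast0LessThan)
  finally show ?thesis .
qed

lemma trace_similar:
  fixes A B :: "'f::comm_semiring_1 mat"
  assumes "similar_mat_wit A B P Q"
  shows "sum_list (diag_mat A) = sum_list (diag_mat B)"
proof -
  obtain n where n: "A \<in> carrier_mat n n"
    using assms by (auto simp: similar_mat_wit_def Let_def)
  note D = similar_mat_witD2[OF n assms]
  have "sum_list (diag_mat A) = sum_list (diag_mat (P * (B * Q)))"
    using D by (metis assoc_mult_mat)
  also have "\<dots> = sum_list (diag_mat (B * Q * P))"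
    using D by (intro trace_mult_comm[of _ n n]) auto
  also have "B * Q * P = B"
    using D by (metis assoc_mult_mat right_mult_one_mat)
  finally show ?thesis .
qed

lemma equivalent_representations_character:
  "equivalent_representations G \<rho> \<sigma> \<Longrightarrow> g \<in> carrier G \<Longrightarrow> character \<rho> g = character \<sigma> g"
  unfolding equivalent_representations_def character_def using trace_similar by blast

lemma mat_mult_sum:
  assumes "A \<in> carrier_mat n m" "B \<in> carrier_mat m k" "i < n" "j < k"
  shows "(A * B) $$ (i, j) = (\<Sum>l<m. A $$ (i, l) * B $$ (l, j))"
  using assms by (simp add: scalar_prod_def atLeast0LessThan)

context group
begin

lemma representationD:
  fixes \<rho> :: "'a \<Rightarrow> 'f::field mat"
  assumes "representation G n \<rho>"
  shows "g \<in> carrier G \<Longrightarrow> \<rho> g \<in> carrier_mat n n"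
    and "\<rho> \<one> = 1\<^sub>m n"
    and "g \<in> carrier G \<Longrightarrow> h \<in> carrier G \<Longrightarrow> \<rho> (g \<otimes> h) = \<rho> g * \<rho> h"
proof -
  let ?R = "ring_mat TYPE('f) n ()"
  interpret R: ring ?R
    by (rule ring_mat)
  interpret group_hom G "units_of ?R" \<rho>
    using assms R.units_group group_axioms by (simp add: group_hom_def group_hom_axioms_def representation_def)
  show "g \<in> carrier G \<Longrightarrow> \<rho> g \<in> carrier_mat n n"
    using assms by (rule representation_carrier_mat)
  show "\<rho> \<one> = 1\<^sub>m n"
    using hom_one by (simp add: units_of_def ring_mat_def)
  show "g \<in> carrier G \<Longrightarrow> h \<in> carrier G \<Longrightarrow> \<rho> (g \<otimes> h) = \<rho> g * \<rho> h"
    using hom_mult by (simp add: units_of_def ring_mat_def)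
qed

text \<open>The values are automatically units: by multiplicativity, \<open>\<rho> (inv g)\<close>
  is a two-sided inverse of \<open>\<rho> g\<close>.\<close>

lemma representationI:
  assumes carr: "\<And>g. g \<in> carrier G \<Longrightarrow> \<rho> g \<in> carrier_mat n n"
    and one: "\<rho> \<one> = 1\<^sub>m n"
    and mult: "\<And>g h. g \<in> carrier G \<Longrightarrow> h \<in> carrier G \<Longrightarrow> \<rho> (g \<otimes> h) = \<rho> g * \<rho> h"
  shows "representation G n \<rho>"
proof -
  have "\<rho> g * \<rho> (inv g) = 1\<^sub>m n" "\<rho> (inv g) * \<rho> g = 1\<^sub>m n" if "g \<in> carrier G" for g
    using that mult[of g "inv g"] mult[of "inv g" g] one by simp_all
  then show ?thesis
    using carr mult unfolding representation_def hom_def units_of_def Units_def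
    by (auto simp: ring_mat_def intro!: bexI[where x = "\<rho> (inv _)"])
qed

end

section \<open>Invariant subspaces and irreducible constituents\<close>

lemma mat_right_inverse_if_surj:
  fixes M :: "'f::comm_ring_1 mat"
  assumes M: "M \<in> carrier_mat m n"
    and surj: "\<And>u. u \<in> carrier_vec m \<Longrightarrow> \<exists>v. v \<in> carrier_vec n \<and> u = M *\<^sub>v v"
  shows "\<exists>N \<in> carrier_mat n m. M * N = 1\<^sub>m m"
proof -
  obtain q where q: "\<And>u. u \<in> carrier_vec m \<Longrightarrow> q u \<in> carrier_vec n \<and> u = M *\<^sub>v q u"
    using surj by metis
  \<comment> \<open>The columns of \<open>N\<close> are preimages of the unit vectors, so
    \<open>M * N\<close> has the unit vectors as columns.\<close>
  define N where "N = mat_of_cols n (map (\<lambda>j. q (unit_vec m j)) [0..<m])"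
  have N: "N \<in> carrier_mat n m"
    using mat_of_cols_carrier(1)[of n "map (\<lambda>j. q (unit_vec m j)) [0..<m]"] unfolding N_def by simp
  have colN: "col N j = q (unit_vec m j)" if "j < m" for j
    using that q by (simp add: N_def)
  have "M * N = 1\<^sub>m m"
  proof (rule mat_col_eqI)
    fix j assume "j < dim_col (1\<^sub>m m :: 'f mat)"
    then have j: "j < m" by simp
    show "col (M * N) j = col (1\<^sub>m m) j"
      using col_mult2[OF M N j] colN[OF j] q[of "unit_vec m j"] j by simp
  qed (use M N in auto)
  with N show ?thesis by blast
qed

lemma mat_right_inverse_dim_le:
  fixes M :: "'f::field mat"
  assumes M: "M \<in> carrier_mat m n" and N: "N \<in> carrier_mat n m" and MN: "M * N = 1\<^sub>m m"
  shows "m \<le> n"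
proof (rule ccontr)
  assume "\<not> m \<le> n"
  then have nm: "n < m" by simp
  \<comment> \<open>Padded to square matrices, one-sided inverses become two-sided, but \<open>N'\<close> has a zero row.\<close>
  define M' where "M' = mat m m (\<lambda>(i, j). if j < n then M $$ (i, j) else 0)"
  define N' where "N' = mat m m (\<lambda>(i, j). if i < n then N $$ (i, j) else 0)"
  have M': "M' \<in> carrier_mat m m" and N': "N' \<in> carrier_mat m m"
    by (auto simp: M'_def N'_def)
  have "M' * N' = M * N"
  proof (rule eq_matI)
    fix i j assume "i < dim_row (M * N)" "j < dim_col (M * N)"
    then have ij: "i < m" "j < m" using M N by auto
    have "(M' * N') $$ (i, j) = (\<Sum>l<m. M' $$ (i, l) * N' $$ (l, j))"
      using mat_mult_sum[OF M' N' ij] .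
    also have "\<dots> = (\<Sum>l<n. M $$ (i, l) * N $$ (l, j))"
      using nm ij by (intro sum.mono_neutral_cong_right) (auto simp: M'_def N'_def)
    also have "\<dots> = (M * N) $$ (i, j)"
      using mat_mult_sum[OF M N ij] by simp
    finally show "(M' * N') $$ (i, j) = (M * N) $$ (i, j)" .
  qed (use M N M' N' in auto)
  then have "N' * M' = 1\<^sub>m m"
    using mat_mult_left_right_inverse[OF M' N'] MN by simp
  then have "(N' * M') $$ (n, n) = 1"
    using nm by simp
  moreover have "(N' * M') $$ (n, n) = 0"
    using nm mat_mult_sum[OF N' M' nm nm] by (simp add: N'_def)
  ultimately show False by simp
qed

text \<open>A basis of \<open>W\<close> is extended to one of the whole space, and the basis vectors
  become the columns of \<open>P\<close>. In the new coordinates \<open>W\<close> consists of the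
  vectors supported on the first \<open>k\<close> entries, which is what makes invariance of
  \<open>W\<close> visible as a zero block.\<close>

lemma (in vec_space) subspace_adapted_basis:
  assumes W: "subspace class_ring W V"
  obtains k P Q where "k \<le> n" "P \<in> carrier_mat n n" "Q \<in> carrier_mat n n"
    "P * Q = 1\<^sub>m n" "Q * P = 1\<^sub>m n"
    "W = {P *\<^sub>v v | v. v \<in> carrier_vec n \<and> (\<forall>i<n. k \<le> i \<longrightarrow> v $ i = 0)}"
proof -
  have WV: "W \<subseteq> carrier_vec n" and subW: "submodule class_ring W V"
    using W by (auto simp: subspace_def submodule_def)
  define ok where "ok A \<longleftrightarrow> A \<subseteq> W \<and> finite A \<and> lin_indpt A" for A
  have "ok {}"
    by (auto simp: ok_def lin_dep_def)
  moreover have "\<forall>A. ok A \<longrightarrow> card A \<le> n"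
    using li_le_dim(2)[OF fin_dim] WV dim_is_n by (auto simp: ok_def)
  \<comment> \<open>An independent subset of \<open>W\<close> of largest size. It spans
    \<open>W\<close>, because any \<open>w\<close> outside its span could be adjoined.\<close>
  ultimately obtain A where A: "ok A" and max: "\<And>A'. ok A' \<Longrightarrow> card A' \<le> card A"
    using ex_has_greatest_nat[of ok "{}" card "Suc n"] by (auto simp: less_Suc_eq_le)
  have A': "A \<subseteq> W" "finite A" "lin_indpt A" "A \<subseteq> carrier_vec n"
    using A WV by (auto simp: ok_def)
  have "W \<subseteq> span A"
  proof
    fix w assume w: "w \<in> W"
    show "w \<in> span A"
    proof (rule ccontr)
      assume nin: "w \<notin> span A"
      have "w \<notin> A"
        using nin in_own_span[of A] A'(4) by auto
      moreover have "lin_indpt (insert w A)"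
        using lin_dep_iff_in_span[OF A'(4,3) _ \<open>w \<notin> A\<close>] w WV nin by (simp add: subset_iff)
      ultimately show False
        using max[of "insert w A"] A' w by (simp add: ok_def)
    qed
  qed
  moreover have "span A \<subseteq> W"
    using span_is_subset[OF A'(1) subW] .
  ultimately have spanA: "span A = W" by auto
  have spanU: "span (set (unit_vecs n)) = carrier_vec n"
    by (rule span_unit_vecs_is_carrier)
  have cardU: "card (set (unit_vecs n :: 'a vec list)) = n"
    using distinct_card[OF unit_vecs_distinct] unit_vecs_length by simp
  \<comment> \<open>Steinitz exchange against the unit vectors bounds \<open>card C\<close> from
    above. Since \<open>A \<union> C\<close> generates the space, the dimension gives the matching
    lower bound, so the sizes add up to exactly \<open>n\<close>.\<close>
  obtain C where C: "finite C" "C \<subseteq> carrier_vec n" "C \<inter> A = {}"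
      "int (card C) \<le> int n - int (card A)" "span (A \<union> C) = carrier_vec n"
    using replacement[OF A'(2) finite_set unit_vecs_carrier A'(3),
        unfolded spanU cardU, OF A'(4)]
    by (elim exE conjE)
  have "dim \<le> card (A \<union> C)"
    using A' C by (intro gen_ge_dim) simp_all
  moreover have "card (A \<union> C) = card A + card C"
    using A' C by (intro card_Un_disjoint) auto
  ultimately have card: "card A + card C = n"
    using C dim_is_n by auto
  obtain as cs where as: "set as = A" "distinct as" and cs: "set cs = C" "distinct cs"
    using finite_distinct_list A' C by metis
  define ws where "ws = as @ cs"
  have len: "length as = card A" "length ws = n"
    using distinct_card[OF as(2)] distinct_card[OF cs(2)] as(1) cs(1) card by (simp_all add: ws_def)
  have wsc: "set ws \<subseteq> carrier_vec n"
    using as cs A' C by (auto simp: ws_def)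
  define P where "P = mat_of_cols n ws"
  have P: "P \<in> carrier_mat n n"
    using mat_of_cols_carrier(1)[of n ws] unfolding len P_def .
  have wsd: "\<forall>w\<in>set ws. dim_vec w = n"
    using wsc by auto
  have lin: "lincomb_list c ws = P *\<^sub>v vec n c" for c
    using lincomb_list_as_mat_mult[OF wsd, of c] unfolding len P_def .
  \<comment> \<open>The columns of \<open>P\<close> generate the space, so \<open>P\<close> is
    surjective; being square, it is then invertible.\<close>
  have "\<exists>v. v \<in> carrier_vec n \<and> u = P *\<^sub>v v" if "u \<in> carrier_vec n" for u
  proof -
    have "u \<in> span_list ws"
      using that C(5) as(1) cs(1) unfolding span_list_as_span[OF wsc] by (simp add: ws_def)
    then obtain c where "u = lincomb_list c ws"
      unfolding span_list_def by blast
    then have "u = P *\<^sub>v vec n c"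
      unfolding lin .
    then show ?thesis
      by (intro exI[of _ "vec n c"]) simp
  qed
  then obtain Q where Q: "Q \<in> carrier_mat n n" and PQ: "P * Q = 1\<^sub>m n"
    using mat_right_inverse_if_surj[OF P] by blast
  have QP: "Q * P = 1\<^sub>m n"
    using mat_mult_left_right_inverse[OF P Q PQ] .
  have Wset: "W = {P *\<^sub>v v | v. v \<in> carrier_vec n \<and> (\<forall>i<n. card A \<le> i \<longrightarrow> v $ i = 0)}" (is "_ = ?R")
  proof -
    \<comment> \<open>The vectors of \<open>A\<close> come first in \<open>ws\<close>, so a
      coordinate vector vanishing from index \<open>card A\<close> on only combines columns that lie
      in \<open>A\<close>.\<close>
    have colP: "P *\<^sub>v v = mat_of_cols n as *\<^sub>v vec (card A) (\<lambda>i. v $ i)"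
      if v: "v \<in> carrier_vec n" "\<forall>i<n. card A \<le> i \<longrightarrow> v $ i = 0" for v
    proof (rule eq_vecI)
      fix i assume "i < dim_vec (mat_of_cols n as *\<^sub>v vec (card A) (\<lambda>i. v $ i))"
      then have i: "i < n" by simp
      have "(P *\<^sub>v v) $ i = (\<Sum>j<n. P $$ (i, j) * v $ j)"
        using i P v by (simp add: scalar_prod_def atLeast0LessThan)
      also have "\<dots> = (\<Sum>j<card A. P $$ (i, j) * v $ j)"
        using card v by (intro sum.mono_neutral_right) auto
      also have "\<dots> = (mat_of_cols n as *\<^sub>v vec (card A) (\<lambda>i. v $ i)) $ i"
        using i len card
        by (simp add: scalar_prod_def atLeast0LessThan P_def ws_def mat_of_cols_def nth_append)
      finally show "(P *\<^sub>v v) $ i = (mat_of_cols n as *\<^sub>v vec (card A) (\<lambda>i. v $ i)) $ i" .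
    qed (use P in auto)
    have W_eq: "W = {mat_of_cols n as *\<^sub>v vec (card A) c | c. True}"
    proof -
      have "\<forall>w\<in>set as. dim_vec w = n"
        using as A'(4) by auto
      then have "lincomb_list c as = mat_of_cols n as *\<^sub>v vec (card A) c" for c
        using lincomb_list_as_mat_mult[of as c] unfolding len by simp
      moreover have "W = span_list as"
        using span_list_as_span[of as] spanA as A' by simp
      ultimately show ?thesis
        unfolding span_list_def by simp
    qed
    show ?thesis
    proof (intro subset_antisym subsetI)
      fix w assume "w \<in> W"
      then obtain c where c: "w = mat_of_cols n as *\<^sub>v vec (card A) c"
        using W_eq by auto
      define v where "v = vec n (\<lambda>i. if i < card A then c i else 0)"
      have v: "v \<in> carrier_vec n" "\<forall>i<n. card A \<le> i \<longrightarrow> v $ i = 0"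
        by (auto simp: v_def)
      have "vec (card A) (\<lambda>i. v $ i) = vec (card A) c"
        using card by (intro eq_vecI) (auto simp: v_def)
      then show "w \<in> ?R"
        using colP[OF v] c v by (auto intro!: exI[of _ v])
    next
      fix w assume "w \<in> ?R"
      then show "w \<in> W"
        unfolding W_eq using colP by auto
    qed
  qed
  show thesis
    using that[of "card A" P Q] card P Q PQ QP Wset by auto
qed

text \<open>Sums and products of functions are the pointwise ones; these are the matching scalars.
  Through \<open>func.span\<close> and \<open>func.independent\<close>, characters are treated as
  vectors in the space of functions on the group.\<close>

interpretation func: vector_space "\<lambda>(c::'f::field) (f::'g\<Rightarrow>'f) x. c * f x"
  by unfold_locales (auto simp: fun_eq_iff algebra_simps)

text \<open>Representations are arbitrary outside the carrier; cutting off there makes equivalent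
  representations have equal characters as functions.\<close>

definition carrier_character :: "('g, 'b) monoid_scheme \<Rightarrow> ('g \<Rightarrow> 'f::field mat) \<Rightarrow> 'g \<Rightarrow> 'f" where
  "carrier_character G \<rho> g = (if g \<in> carrier G then character \<rho> g else 0)"

section \<open>Decomposing characters into irreducible ones\<close>

context group
begin

lemma representation_conjugate:
  fixes \<rho> :: "'a \<Rightarrow> 'f::field mat"
  assumes \<rho>: "representation G n \<rho>"
    and PQ: "P \<in> carrier_mat n n" "Q \<in> carrier_mat n n" "P * Q = 1\<^sub>m n" "Q * P = 1\<^sub>m n"
  shows "representation G n (\<lambda>g. Q * \<rho> g * P)"
    and "g \<in> carrier G \<Longrightarrow> character (\<lambda>g. Q * \<rho> g * P) g = character \<rho> g"
proof -
  note D = representationD[OF \<rho>]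
  show "representation G n (\<lambda>g. Q * \<rho> g * P)"
  proof (rule representationI)
    fix g h assume gh: "g \<in> carrier G" "h \<in> carrier G"
    have c: "\<rho> g \<in> carrier_mat n n" "\<rho> h \<in> carrier_mat n n"
      using gh D by auto
    have "Q * \<rho> g * P * (Q * \<rho> h * P) = Q * \<rho> g * (P * Q) * (\<rho> h * P)"
      using c PQ(1,2) by (simp add: assoc_mult_mat[of _ n n _ n _ n])
    also have "\<dots> = Q * (\<rho> g * \<rho> h) * P"
      unfolding PQ(3) using c PQ(1,2) by (simp add: assoc_mult_mat[of _ n n _ n _ n])
    finally show "Q * \<rho> (g \<otimes> h) * P = Q * \<rho> g * P * (Q * \<rho> h * P)"
      using D(3) gh by simp
  qed (use D PQ in auto)
  show "character (\<lambda>g. Q * \<rho> g * P) g = character \<rho> g" if "g \<in> carrier G"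
  proof -
    have "similar_mat_wit (Q * \<rho> g * P) (\<rho> g) Q P"
      using PQ D(1)[OF that] by (simp add: similar_mat_wit_def Let_def)
    then show ?thesis
      unfolding character_def by (rule trace_similar)
  qed
qed

text \<open>Multiplying block upper triangular matrices multiplies their diagonal blocks, so both
  blocks are representations: \<alpha> on the invariant subspace, \<beta> on the quotient. The trace
  is the sum of the two block traces.\<close>

lemma representation_block_triangular:
  fixes \<rho> :: "'a \<Rightarrow> 'f::field mat"
  assumes \<rho>: "representation G n \<rho>" and k: "k \<le> n"
    and zero: "\<And>g i j. g \<in> carrier G \<Longrightarrow> i < n \<Longrightarrow> k \<le> i \<Longrightarrow> j < k \<Longrightarrow> \<rho> g $$ (i, j) = 0"
  defines "\<alpha> \<equiv> \<lambda>g. mat k k (\<lambda>(i, j). \<rho> g $$ (i, j))"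
    and "\<beta> \<equiv> \<lambda>g. mat (n - k) (n - k) (\<lambda>(i, j). \<rho> g $$ (i + k, j + k))"
  shows "representation G k \<alpha>" and "representation G (n - k) \<beta>"
    and "g \<in> carrier G \<Longrightarrow> character \<rho> g = character \<alpha> g + character \<beta> g"
proof -
  note D = representationD[OF \<rho>]
  have split: "(\<Sum>l<n. f l) = (\<Sum>l<k. f l) + (\<Sum>l<n-k. f (l + k))" for f :: "nat \<Rightarrow> 'f"
  proof -
    have "(\<Sum>l<n. f l) = (\<Sum>l<k. f l) + (\<Sum>l\<in>{k..<n}. f l)"
      using k sum.atLeastLessThan_concat[of 0 k n f] by (simp add: atLeast0LessThan)
    also have "(\<Sum>l\<in>{k..<n}. f l) = (\<Sum>l<n-k. f (l + k))"
      using k sum.shift_bounds_nat_ivl[of f 0 k "n - k"] by (simp add: atLeast0LessThan)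
    finally show ?thesis .
  qed
  \<comment> \<open>In the sum over \<open>l\<close>, split at \<open>k\<close>, the second part
    vanishes on the upper left block and the first part on the lower right one, in each case because
    of the zero block.\<close>
  have prod: "\<rho> (g \<otimes> h) $$ (i, j)
      = (\<Sum>l<k. \<rho> g $$ (i, l) * \<rho> h $$ (l, j)) + (\<Sum>l<n-k. \<rho> g $$ (i, l + k) * \<rho> h $$ (l + k, j))"
    if "g \<in> carrier G" "h \<in> carrier G" "i < n" "j < n" for g h i j
    using that D mat_mult_sum[of "\<rho> g" n n "\<rho> h" n i j] split by simp
  show "representation G k \<alpha>"
  proof (rule representationI)
    show "\<alpha> \<one> = 1\<^sub>m k"
      using D(2) k by (intro eq_matI) (auto simp: \<alpha>_def)
    fix g h assume gh: "g \<in> carrier G" "h \<in> carrier G"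
    show "\<alpha> (g \<otimes> h) = \<alpha> g * \<alpha> h"
    proof (rule eq_matI)
      fix i j assume "i < dim_row (\<alpha> g * \<alpha> h)" "j < dim_col (\<alpha> g * \<alpha> h)"
      then have ij: "i < k" "j < k" by (auto simp: \<alpha>_def)
      show "\<alpha> (g \<otimes> h) $$ (i, j) = (\<alpha> g * \<alpha> h) $$ (i, j)"
        using ij k gh prod[OF gh, of i j] mat_mult_sum[of "\<alpha> g" k k "\<alpha> h" k i j] zero
        by (simp add: \<alpha>_def)
    qed (auto simp: \<alpha>_def)
  qed (auto simp: \<alpha>_def)
  show "representation G (n - k) \<beta>"
  proof (rule representationI)
    show "\<beta> \<one> = 1\<^sub>m (n - k)"
      using D(2) k by (intro eq_matI) (auto simp: \<beta>_def)
    fix g h assume gh: "g \<in> carrier G" "h \<in> carrier G"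
    show "\<beta> (g \<otimes> h) = \<beta> g * \<beta> h"
    proof (rule eq_matI)
      fix i j assume "i < dim_row (\<beta> g * \<beta> h)" "j < dim_col (\<beta> g * \<beta> h)"
      then have ij: "i < n - k" "j < n - k" by (auto simp: \<beta>_def)
      show "\<beta> (g \<otimes> h) $$ (i, j) = (\<beta> g * \<beta> h) $$ (i, j)"
        using ij k gh prod[OF gh, of "i + k" "j + k"]
          mat_mult_sum[of "\<beta> g" "n - k" "n - k" "\<beta> h" "n - k" i j] zero
        by (simp add: \<beta>_def)
    qed (auto simp: \<beta>_def)
  qed (auto simp: \<beta>_def)
  show "character \<rho> g = character \<alpha> g + character \<beta> g" if "g \<in> carrier G"
  proof -
    have "character \<alpha> g = (\<Sum>i<k. \<rho> g $$ (i, i))"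
      unfolding character_def by (subst sum_list_diag_mat[of _ k k]) (auto simp: \<alpha>_def)
    moreover have "character \<beta> g = (\<Sum>i<n-k. \<rho> g $$ (i + k, i + k))"
      unfolding character_def by (subst sum_list_diag_mat[of _ "n-k" "n-k"]) (auto simp: \<beta>_def)
    ultimately show ?thesis
      using D(1)[OF that] unfolding character_def by (subst sum_list_diag_mat[of _ n n]) (auto simp: split)
  qed
qed

text \<open>Reducibility supplies a proper nonzero invariant subspace. In a basis adapted to it the
  representation is block triangular, and its character is the sum of those of the subrepresentation
  and the quotient.\<close>

lemma reducible_representation_split:
  fixes \<rho> :: "'a \<Rightarrow> 'f::field mat"
  assumes \<rho>: "representation G n \<rho>" and "0 < n" and irr: "\<not> irreducible_representation G n \<rho>"
  obtains k \<alpha> \<beta> where "0 < k" "k < n" "representation G k (\<alpha> :: 'a \<Rightarrow> 'f mat)"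
    "representation G (n - k) (\<beta> :: 'a \<Rightarrow> 'f mat)"
    "\<And>g. g \<in> carrier G \<Longrightarrow> character \<rho> g = character \<alpha> g + character \<beta> g"
proof -
  interpret vec_space "TYPE('f)" n .
  note D = representationD[OF \<rho>]
  obtain W where W: "VectorSpace.subspace class_ring W (module_vec TYPE('f) n)"
    and inv: "\<And>g v. g \<in> carrier G \<Longrightarrow> v \<in> W \<Longrightarrow> \<rho> g *\<^sub>v v \<in> W"
    and W0: "W \<noteq> {0\<^sub>v n}" and W1: "W \<noteq> carrier_vec n"
    using assms unfolding irreducible_representation_def by auto
  obtain k P Q where k: "k \<le> n" and PQ: "P \<in> carrier_mat n n" "Q \<in> carrier_mat n n"
    "P * Q = 1\<^sub>m n" "Q * P = 1\<^sub>m n"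
    and W_eq: "W = {P *\<^sub>v v | v. v \<in> carrier_vec n \<and> (\<forall>i<n. k \<le> i \<longrightarrow> v $ i = 0)}"
    using subspace_adapted_basis[OF W] .
  have "k \<noteq> 0"
  proof
    assume "k = 0"
    then have "v = 0\<^sub>v n" if "v \<in> carrier_vec n \<and> (\<forall>i<n. k \<le> i \<longrightarrow> v $ i = 0)" for v :: "'f vec"
      using that by (intro eq_vecI) auto
    then have "W = {P *\<^sub>v 0\<^sub>v n}"
      unfolding W_eq by (auto intro!: exI[of _ "0\<^sub>v n"])
    also have "P *\<^sub>v 0\<^sub>v n = 0\<^sub>v n"
      using PQ(1) by (intro eq_vecI) (auto simp: scalar_prod_def)
    finally show False using W0 by simp
  qed
  have "k \<noteq> n"
  proof
    assume kn: "k = n"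
    have "u \<in> W" if u: "u \<in> carrier_vec n" for u
    proof -
      have "u = P *\<^sub>v (Q *\<^sub>v u)"
        using u PQ(1-3) by (metis assoc_mult_mat_vec one_mult_mat_vec)
      then show ?thesis
        unfolding W_eq using kn PQ(2) u by (auto intro!: exI[of _ "Q *\<^sub>v u"])
    qed
    then show False using W1 unfolding W_eq using PQ(1) by auto
  qed
  let ?\<sigma> = "\<lambda>g. Q * \<rho> g * P"
  \<comment> \<open>For \<open>j < k\<close>, column \<open>j\<close> of the conjugate holds the new
    coordinates of \<open>\<rho> g\<close> applied to a basis vector of \<open>W\<close>. The result
    lies in \<open>W\<close> again, so its coordinates from \<open>k\<close> on are zero.\<close>
  have zero: "?\<sigma> g $$ (i, j) = 0" if g: "g \<in> carrier G" and ij: "i < n" "k \<le> i" "j < k" for g i j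
  proof -
    have jn: "j < n" using ij k by simp
    have c: "\<rho> g \<in> carrier_mat n n" using g D by auto
    have "P *\<^sub>v unit_vec n j \<in> W"
      unfolding W_eq using ij jn by (auto intro!: exI[of _ "unit_vec n j"])
    then have "\<rho> g *\<^sub>v (P *\<^sub>v unit_vec n j) \<in> W"
      using inv g by blast
    then obtain v where v: "v \<in> carrier_vec n" "\<forall>i<n. k \<le> i \<longrightarrow> v $ i = 0"
      "\<rho> g *\<^sub>v (P *\<^sub>v unit_vec n j) = P *\<^sub>v v"
      unfolding W_eq by auto
    have "col (?\<sigma> g) j = ?\<sigma> g *\<^sub>v unit_vec n j"
      using jn c PQ by (intro eq_vecI) auto
    also have "\<dots> = Q *\<^sub>v (\<rho> g *\<^sub>v (P *\<^sub>v unit_vec n j))"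
      using c PQ(1,2) by (simp add: assoc_mult_mat_vec[of _ n n _ n])
    also have "\<dots> = v"
      unfolding v(3) using v(1) PQ(1,2,4) by (metis assoc_mult_mat_vec one_mult_mat_vec)
    finally have "?\<sigma> g $$ (i, j) = v $ i"
      using ij jn c PQ(1,2) by (metis index_col index_mult_mat(2,3) carrier_matD)
    then show ?thesis using v(2) ij by simp
  qed
  note conj = representation_conjugate[OF \<rho> PQ]
  show thesis
    using that[OF _ _ representation_block_triangular(1,2)[OF conj(1) k zero]]
      representation_block_triangular(3)[OF conj(1) k zero] conj(2) k \<open>k \<noteq> 0\<close> \<open>k \<noteq> n\<close>
    by fastforce
qed

text \<open>Induction on the degree: a reducible representation splits into two of smaller positive
  degree. Degree 0 is a separate case, since irreducibility demands a positive degree; there the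
  trace is an empty sum.\<close>

lemma carrier_character_in_span_irreducibles:
  fixes \<rho> :: "'a \<Rightarrow> 'f::field mat"
  shows "representation G n \<rho> \<Longrightarrow>
    carrier_character G \<rho> \<in> func.span (carrier_character G ` irreducibles G)"
proof (induction n arbitrary: \<rho> rule: less_induct)
  case (less n)
  consider "n = 0" | "irreducible_representation G n \<rho>" | "0 < n" "\<not> irreducible_representation G n \<rho>"
    by blast
  then show ?case
  proof cases
    case 1
    then have eq: "carrier_character G \<rho> = 0"
      using representationD(1)[OF less.prems]
      by (auto simp: fun_eq_iff carrier_character_def character_def sum_list_diag_mat[of _ 0 0])
    show ?thesis unfolding eq by (rule func.span_zero)
  next
    case 2
    then show ?thesis
      by (intro func.span_base) (auto simp: irreducibles_def)
  next
    case 3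
    obtain k \<alpha> \<beta> where s: "0 < k" "k < n" "representation G k (\<alpha> :: 'a \<Rightarrow> 'f mat)"
      "representation G (n - k) (\<beta> :: 'a \<Rightarrow> 'f mat)"
      "\<And>g. g \<in> carrier G \<Longrightarrow> character \<rho> g = character \<alpha> g + character \<beta> g"
      using reducible_representation_split[OF less.prems 3] by blast
    have eq: "carrier_character G \<rho> = carrier_character G \<alpha> + carrier_character G \<beta>"
      using s(5) by (auto simp: fun_eq_iff carrier_character_def)
    show ?thesis
      unfolding eq using s(1,2) by (intro func.span_add less.IH[OF s(2,3)] less.IH[OF _ s(4)]) simp
  qed
qed

end

section \<open>Schur's lemma and orthogonality\<close>

lemma (in vec_space) subspaceI:
  assumes "W \<subseteq> carrier_vec n" "0\<^sub>v n \<in> W"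
    and "\<And>v w. v \<in> W \<Longrightarrow> w \<in> W \<Longrightarrow> v + w \<in> W"
    and "\<And>c v. v \<in> W \<Longrightarrow> c \<cdot>\<^sub>v v \<in> W"
  shows "subspace class_ring W V"
proof -
  have "- v \<in> W" if "v \<in> W" for v
  proof -
    have "(-1) \<cdot>\<^sub>v v = - v"
      using that assms(1) by (intro eq_vecI) auto
    then show ?thesis using assms(4)[OF that, of "-1"] by simp
  qed
  then show ?thesis
    unfolding subspace_def submodule_def using assms vec_vs vec_module by auto
qed

lemma subspace_mat_kernel:
  fixes M :: "'f::field mat"
  assumes M: "M \<in> carrier_mat m n"
  shows "VectorSpace.subspace class_ring {v \<in> carrier_vec n. M *\<^sub>v v = 0\<^sub>v m} (module_vec TYPE('f) n)"
proof -
  interpret vec_space "TYPE('f)" n .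
  show ?thesis
    by (rule subspaceI) (use M in \<open>auto simp: mult_add_distrib_mat_vec mult_mat_vec\<close>)
qed

lemma subspace_mat_image:
  fixes M :: "'f::field mat"
  assumes M: "M \<in> carrier_mat m n"
  shows "VectorSpace.subspace class_ring {M *\<^sub>v v | v. v \<in> carrier_vec n} (module_vec TYPE('f) m)"
proof -
  interpret vec_space "TYPE('f)" m .
  show ?thesis
  proof (rule subspaceI)
    have "M *\<^sub>v 0\<^sub>v n = 0\<^sub>v m"
      using M by (intro eq_vecI) auto
    then show "0\<^sub>v m \<in> {M *\<^sub>v v | v. v \<in> carrier_vec n}"
      by (metis (mono_tags, lifting) mem_Collect_eq zero_carrier_vec)
  next
    fix v w assume "v \<in> {M *\<^sub>v v | v. v \<in> carrier_vec n}" "w \<in> {M *\<^sub>v v | v. v \<in> carrier_vec n}"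
    then show "v + w \<in> {M *\<^sub>v v | v. v \<in> carrier_vec n}"
      using M by (auto simp: mult_add_distrib_mat_vec[symmetric])
  next
    fix c v assume "v \<in> {M *\<^sub>v v | v. v \<in> carrier_vec n}"
    then show "c \<cdot>\<^sub>v v \<in> {M *\<^sub>v v | v. v \<in> carrier_vec n}"
      using M by (auto simp: mult_mat_vec[symmetric])
  qed (use M in auto)
qed

lemma mat_eq_0_if_mult_vec_eq_0:
  fixes M :: "'f::comm_ring_1 mat"
  assumes M: "M \<in> carrier_mat m n" and 0: "\<And>v. v \<in> carrier_vec n \<Longrightarrow> M *\<^sub>v v = 0\<^sub>v m"
  shows "M = 0\<^sub>m m n"
proof (rule eq_matI)
  fix i j assume ij: "i < dim_row (0\<^sub>m m n :: 'f mat)" "j < dim_col (0\<^sub>m m n :: 'f mat)"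
  then have "(M *\<^sub>v unit_vec n j) $ i = 0"
    using 0[of "unit_vec n j"] by simp
  then show "M $$ (i, j) = 0\<^sub>m m n $$ (i, j)"
    using ij M by simp
qed (use M in auto)

lemma irreducible_representationD:
  fixes \<rho> :: "'g \<Rightarrow> 'f::field mat"
  assumes "irreducible_representation G n \<rho>"
    and "VectorSpace.subspace class_ring W (module_vec TYPE('f) n)"
    and "\<And>g v. g \<in> carrier G \<Longrightarrow> v \<in> W \<Longrightarrow> \<rho> g *\<^sub>v v \<in> W"
  shows "W = {0\<^sub>v n} \<or> W = carrier_vec n"
  using assms unfolding irreducible_representation_def by blast

context group
begin

text \<open>Kernel and image of an intertwining matrix \<open>M\<close> are invariant subspaces. As
  \<open>M\<close> is nonzero, irreducibility forces the kernel to be zero and the image to be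
  everything, so \<open>M\<close> is invertible and conjugates one representation into the
  other.\<close>

lemma schur:
  fixes \<rho> \<sigma> :: "'a \<Rightarrow> 'f::field mat"
  assumes irr: "irreducible_representation G n \<rho>" "irreducible_representation G m \<sigma>"
    and M: "M \<in> carrier_mat m n"
    and comm: "\<And>h. h \<in> carrier G \<Longrightarrow> \<sigma> h * M = M * \<rho> h"
    and M0: "M \<noteq> 0\<^sub>m m n"
  shows "equivalent_representations G \<sigma> \<rho>"
proof -
  have rep: "representation G n \<rho>" "representation G m \<sigma>"
    using irr by (auto simp: irreducible_representation_def)
  note D\<rho> = representationD[OF rep(1)] and D\<sigma> = representationD[OF rep(2)]
  have comm_vec: "\<sigma> h *\<^sub>v (M *\<^sub>v v) = M *\<^sub>v (\<rho> h *\<^sub>v v)" if "h \<in> carrier G" "v \<in> carrier_vec n" for h v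
    using assoc_mult_mat_vec[OF D\<sigma>(1)[OF that(1)] M that(2)]
      assoc_mult_mat_vec[OF M D\<rho>(1)[OF that(1)] that(2)] comm[OF that(1)] by simp
  let ?K = "{v \<in> carrier_vec n. M *\<^sub>v v = 0\<^sub>v m}" and ?I = "{M *\<^sub>v v | v. v \<in> carrier_vec n}"
  have "?K = {0\<^sub>v n} \<or> ?K = carrier_vec n"
  proof (rule irreducible_representationD[OF irr(1) subspace_mat_kernel[OF M]])
    fix g v assume g: "g \<in> carrier G" and v: "v \<in> ?K"
    have "M *\<^sub>v (\<rho> g *\<^sub>v v) = \<sigma> g *\<^sub>v 0\<^sub>v m"
      using comm_vec[OF g, of v] v by simp
    also have "\<dots> = 0\<^sub>v m"
      using D\<sigma>(1)[OF g] by (intro eq_vecI) auto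
    finally show "\<rho> g *\<^sub>v v \<in> ?K"
      using D\<rho>(1)[OF g] v by simp
  qed
  then have ker: "v = 0\<^sub>v n" if "v \<in> carrier_vec n" "M *\<^sub>v v = 0\<^sub>v m" for v
    using mat_eq_0_if_mult_vec_eq_0[OF M] M0 that by blast
  have "?I = {0\<^sub>v m} \<or> ?I = carrier_vec m"
  proof (rule irreducible_representationD[OF irr(2) subspace_mat_image[OF M]])
    fix g v assume g: "g \<in> carrier G" and v: "v \<in> ?I"
    then show "\<sigma> g *\<^sub>v v \<in> ?I"
      using comm_vec[OF g] D\<rho>(1)[OF g] by fastforce
  qed
  then have "?I = carrier_vec m"
    using mat_eq_0_if_mult_vec_eq_0[OF M] M0 by blast
  then obtain N where N: "N \<in> carrier_mat n m" and MN: "M * N = 1\<^sub>m m"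
    using mat_right_inverse_if_surj[OF M] by blast
  \<comment> \<open>The right inverse \<open>N\<close> is also a left inverse:
    \<open>N *\<^sub>v (M *\<^sub>v v) - v\<close> lies in the kernel of \<open>M\<close>, which is
    zero.\<close>
  have NM: "N * M = 1\<^sub>m n"
  proof -
    have NM_vec: "N *\<^sub>v (M *\<^sub>v v) = v" if v: "v \<in> carrier_vec n" for v
    proof -
      have "M *\<^sub>v (N *\<^sub>v (M *\<^sub>v v)) = M *\<^sub>v v"
        using assoc_mult_mat_vec[OF M N, of "M *\<^sub>v v"] v M MN by simp
      then have "M *\<^sub>v (N *\<^sub>v (M *\<^sub>v v) - v) = 0\<^sub>v m"
        using v M N by (simp add: mult_minus_distrib_mat_vec[OF M])
      then have 0: "N *\<^sub>v (M *\<^sub>v v) - v = 0\<^sub>v n"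
        using v M N by (intro ker) auto
      show ?thesis
      proof (rule eq_vecI)
        fix i assume i: "i < dim_vec v"
        then have "(N *\<^sub>v (M *\<^sub>v v) - v) $ i = 0"
          unfolding 0 using v by simp
        then show "(N *\<^sub>v (M *\<^sub>v v)) $ i = v $ i"
          using i by simp
      qed (use v N in auto)
    qed
    show ?thesis
    proof (rule mat_col_eqI)
      fix j assume "j < dim_col (1\<^sub>m n :: 'f mat)"
      then have j: "j < n" by simp
      have "M *\<^sub>v unit_vec n j = col M j"
        using j M by (intro eq_vecI) auto
      then have "col (N * M) j = N *\<^sub>v (M *\<^sub>v unit_vec n j)"
        using col_mult2[OF N M j] by simp
      then show "col (N * M) j = col (1\<^sub>m n) j"
        using NM_vec[of "unit_vec n j"] j by simp
    qed (use M N in auto)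
  qed
  \<comment> \<open>Each of \<open>M\<close> and \<open>N\<close> has a right inverse, which gives
    the two inequalities between the degrees. Similarity is only defined for square matrices of
    equal size.\<close>
  have nm: "n = m"
    using mat_right_inverse_dim_le[OF M N MN] mat_right_inverse_dim_le[OF N M NM] by simp
  have "similar_mat_wit (\<sigma> h) (\<rho> h) M N" if h: "h \<in> carrier G" for h
  proof -
    have "\<sigma> h = \<sigma> h * (M * N)"
      using D\<sigma>(1)[OF h] unfolding MN by simp
    also have "\<dots> = M * \<rho> h * N"
      using comm[OF h] assoc_mult_mat[OF D\<sigma>(1)[OF h] M N] by simp
    finally show ?thesis
      using D\<sigma>(1)[OF h] D\<rho>(1)[OF h] M N MN NM nm by (simp add: similar_mat_wit_def Let_def)
  qed
  then show ?thesis
    unfolding equivalent_representations_def by blast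
qed

text \<open>These sums are the entries of a matrix intertwining the two representations, which
  Schur's lemma forces to be zero.\<close>

lemma schur_orthogonality:
  fixes \<rho> \<sigma> :: "'a \<Rightarrow> 'f::field mat"
  assumes irr: "irreducible_representation G n \<rho>" "irreducible_representation G m \<sigma>"
    and neq: "\<not> equivalent_representations G \<sigma> \<rho>"
    and ij: "i < m" "b < m" "c < n" "j < n"
  shows "(\<Sum>g\<in>carrier G. \<sigma> g $$ (i, b) * \<rho> (inv g) $$ (c, j)) = 0"
proof -
  have rep: "representation G n \<rho>" "representation G m \<sigma>"
    using irr by (auto simp: irreducible_representation_def)
  note D\<rho> = representationD[OF rep(1)] and D\<sigma> = representationD[OF rep(2)]
  \<comment> \<open>the average of \<open>\<sigma> g * E * \<rho> (inv g)\<close> over the group, \<open>E\<close> the matrix unit at \<open>(b, c)\<close>\<close>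
  define M where "M = mat m n (\<lambda>(i, j). \<Sum>g\<in>carrier G. \<sigma> g $$ (i, b) * \<rho> (inv g) $$ (c, j))"
  have M: "M \<in> carrier_mat m n" by (simp add: M_def)
  have "\<sigma> h * M = M * \<rho> h" if h: "h \<in> carrier G" for h
  proof (rule eq_matI)
    fix i j assume "i < dim_row (M * \<rho> h)" "j < dim_col (M * \<rho> h)"
    then have ij': "i < m" "j < n" using M D\<rho>(1)[OF h] by auto
    have "(\<sigma> h * M) $$ (i, j)
        = (\<Sum>l<m. \<Sum>g\<in>carrier G. \<sigma> h $$ (i, l) * (\<sigma> g $$ (l, b) * \<rho> (inv g) $$ (c, j)))"
      using mat_mult_sum[OF D\<sigma>(1)[OF h] M ij'] ij' by (simp add: M_def sum_distrib_left)
    also have "\<dots> = (\<Sum>g\<in>carrier G. (\<Sum>l<m. \<sigma> h $$ (i, l) * \<sigma> g $$ (l, b)) * \<rho> (inv g) $$ (c, j))"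
      by (subst sum.swap) (simp add: sum_distrib_right mult.assoc)
    also have "\<dots> = (\<Sum>g\<in>carrier G. \<sigma> (h \<otimes> g) $$ (i, b) * \<rho> (inv g) $$ (c, j))"
      using h ij ij' D\<sigma> mat_mult_sum[of "\<sigma> h" m m _ m i b] by (intro sum.cong) auto
    \<comment> \<open>Replacing \<open>g\<close> by \<open>inv h \<otimes> g\<close> moves
      \<open>h\<close> from the left of \<sigma> to the right of \<rho>.\<close>
    also have "\<dots> = (\<Sum>g\<in>carrier G. \<sigma> g $$ (i, b) * \<rho> (inv g \<otimes> h) $$ (c, j))"
      using h by (intro sum.reindex_bij_witness[of _ "\<lambda>g. inv h \<otimes> g" "\<lambda>g. h \<otimes> g"])
        (auto simp: inv_mult_group m_assoc[symmetric], simp_all add: m_assoc)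
    also have "\<dots> = (\<Sum>g\<in>carrier G. \<sigma> g $$ (i, b) * (\<Sum>l<n. \<rho> (inv g) $$ (c, l) * \<rho> h $$ (l, j)))"
      using h ij ij' D\<rho> mat_mult_sum[of _ n n "\<rho> h" n c j] by (intro sum.cong) auto
    also have "\<dots> = (\<Sum>l<n. (\<Sum>g\<in>carrier G. \<sigma> g $$ (i, b) * \<rho> (inv g) $$ (c, l)) * \<rho> h $$ (l, j))"
      by (simp add: sum_distrib_left sum_distrib_right mult.assoc) (rule sum.swap)
    also have "\<dots> = (M * \<rho> h) $$ (i, j)"
      using mat_mult_sum[OF M D\<rho>(1)[OF h] ij'] ij' by (simp add: M_def)
    finally show "(\<sigma> h * M) $$ (i, j) = (M * \<rho> h) $$ (i, j)" .
  qed (use M h D\<rho> D\<sigma> in auto)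
  then have "M = 0\<^sub>m m n"
    using schur[OF irr M] neq by blast
  then have "M $$ (i, j) = 0" using ij by simp
  then show ?thesis using ij by (simp add: M_def)
qed

end

section \<open>Tensor products and the regular representation\<close>

text \<open>Division with remainder by \<open>m\<close> is a bijection from the indices below
  \<open>n * m\<close> to pairs; it is the indexing used for Kronecker products. For
  \<open>m = 0\<close> both sides are sums of nothing.\<close>

lemma sum_div_mod:
  fixes f :: "nat \<Rightarrow> nat \<Rightarrow> 'f::comm_monoid_add"
  shows "(\<Sum>l<n * m. f (l div m) (l mod m)) = (\<Sum>a<n. \<Sum>b<m. f a b)"
proof -
  have lt: "a * m + b < n * m" if "a < n" "b < m" for a b
  proof -
    have "a * m + b < Suc a * m" using that by simp
    also have "\<dots> \<le> n * m" using that by (intro mult_le_mono1) simp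
    finally show ?thesis .
  qed
  have m: "0 < m" if "l < n * m" for l
    using that by (cases m) auto
  have "(\<Sum>l<n * m. f (l div m) (l mod m)) = (\<Sum>(a, b)\<in>{..<n} \<times> {..<m}. f a b)"
    by (rule sum.reindex_bij_witness[of _ "\<lambda>(a, b). a * m + b" "\<lambda>l. (l div m, l mod m)"])
      (auto simp: lt m less_mult_imp_div_less)
  then show ?thesis by (simp add: sum.cartesian_product)
qed

definition kronecker_mat :: "'f::comm_semiring_1 mat \<Rightarrow> 'f mat \<Rightarrow> 'f mat" where
  "kronecker_mat A B = mat (dim_row A * dim_row B) (dim_col A * dim_col B)
     (\<lambda>(i, j). A $$ (i div dim_row B, j div dim_col B) * B $$ (i mod dim_row B, j mod dim_col B))"

lemma kronecker_mat_carrier: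
  "A \<in> carrier_mat n n' \<Longrightarrow> B \<in> carrier_mat m m' \<Longrightarrow> kronecker_mat A B \<in> carrier_mat (n * m) (n' * m')"
  by (auto simp: kronecker_mat_def)

lemma div_mod_less_mult:
  fixes i m n :: nat
  assumes "i < n * m"
  shows "i div m < n" "i mod m < m"
  using assms by (cases "m = 0"; simp add: less_mult_imp_div_less)+

lemma kronecker_mat_one: "kronecker_mat (1\<^sub>m n) (1\<^sub>m m) = 1\<^sub>m (n * m)"
proof (rule eq_matI)
  fix i j assume "i < dim_row (1\<^sub>m (n * m))" "j < dim_col (1\<^sub>m (n * m))"
  then have ij: "i < n * m" "j < n * m" by simp_all
  have "i div m = j div m \<and> i mod m = j mod m \<longleftrightarrow> i = j"
    by (metis div_mult_mod_eq)
  then show "kronecker_mat (1\<^sub>m n) (1\<^sub>m m) $$ (i, j) = 1\<^sub>m (n * m) $$ (i, j)"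
    using ij div_mod_less_mult[OF ij(1)] div_mod_less_mult[OF ij(2)]
    by (auto simp: kronecker_mat_def)
qed (auto simp: kronecker_mat_def)

text \<open>The summation index of the matrix product splits into quotient and remainder by
  \<open>m'\<close>, and the double sum factors into the entries of \<open>A * A'\<close> and
  \<open>B * B'\<close>.\<close>

lemma kronecker_mat_mult:
  assumes A: "A \<in> carrier_mat n n'" "A' \<in> carrier_mat n' n''"
    and B: "B \<in> carrier_mat m m'" "B' \<in> carrier_mat m' m''"
  shows "kronecker_mat (A * A') (B * B') = kronecker_mat A B * kronecker_mat A' B'"
proof (rule eq_matI)
  note K = kronecker_mat_carrier[OF A(1) B(1)] kronecker_mat_carrier[OF A(2) B(2)]
  fix i j assume "i < dim_row (kronecker_mat A B * kronecker_mat A' B')"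
    "j < dim_col (kronecker_mat A B * kronecker_mat A' B')"
  then have ij: "i < n * m" "j < n'' * m''" using K by auto
  note dm = div_mod_less_mult[OF ij(1)] div_mod_less_mult[OF ij(2)]
  have "(kronecker_mat A B * kronecker_mat A' B') $$ (i, j) = (\<Sum>l<n' * m'.
      A $$ (i div m, l div m') * B $$ (i mod m, l mod m') *
      (A' $$ (l div m', j div m'') * B' $$ (l mod m', j mod m'')))"
    using mat_mult_sum[OF K ij] A B ij by (simp add: kronecker_mat_def)
  also have "\<dots> = (\<Sum>a<n'. \<Sum>b<m'. A $$ (i div m, a) * B $$ (i mod m, b) *
      (A' $$ (a, j div m'') * B' $$ (b, j mod m'')))"
    by (rule sum_div_mod)
  also have "\<dots> = (\<Sum>a<n'. A $$ (i div m, a) * A' $$ (a, j div m''))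
      * (\<Sum>b<m'. B $$ (i mod m, b) * B' $$ (b, j mod m''))"
    by (simp add: sum_product ac_simps)
  also have "\<dots> = kronecker_mat (A * A') (B * B') $$ (i, j)"
    using ij A B mat_mult_sum[OF A dm(1,3)] mat_mult_sum[OF B dm(2,4)] by (simp add: kronecker_mat_def)
  finally show "kronecker_mat (A * A') (B * B') $$ (i, j)
      = (kronecker_mat A B * kronecker_mat A' B') $$ (i, j)" by simp
qed (use A B in \<open>auto simp: kronecker_mat_def\<close>)

lemma trace_kronecker_mat:
  assumes A: "A \<in> carrier_mat n n" and B: "B \<in> carrier_mat m m"
  shows "sum_list (diag_mat (kronecker_mat A B)) = sum_list (diag_mat A) * sum_list (diag_mat B)"
proof -
  have "sum_list (diag_mat (kronecker_mat A B))
      = (\<Sum>l<n * m. A $$ (l div m, l div m) * B $$ (l mod m, l mod m))"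
    unfolding sum_list_diag_mat[OF kronecker_mat_carrier[OF A B]] using A B by (simp add: kronecker_mat_def)
  also have "\<dots> = (\<Sum>a<n. \<Sum>b<m. A $$ (a, a) * B $$ (b, b))"
    by (rule sum_div_mod)
  also have "\<dots> = sum_list (diag_mat A) * sum_list (diag_mat B)"
    by (simp add: sum_list_diag_mat[OF A] sum_list_diag_mat[OF B] sum_product)
  finally show ?thesis .
qed

context group
begin

text \<open>Realises the pointwise product of two characters as a character; this is the source of
  the algebra structure on the span.\<close>

lemma representation_tensor:
  fixes \<rho> \<sigma> :: "'a \<Rightarrow> 'f::field mat"
  assumes "representation G n \<rho>" "representation G m \<sigma>"
  shows "representation G (n * m) (\<lambda>g. kronecker_mat (\<rho> g) (\<sigma> g))"
    and "carrier_character G (\<lambda>g. kronecker_mat (\<rho> g) (\<sigma> g)) = carrier_character G \<rho> * carrier_character G \<sigma>"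
proof -
  note D = representationD[OF assms(1)] representationD[OF assms(2)]
  show "representation G (n * m) (\<lambda>g. kronecker_mat (\<rho> g) (\<sigma> g))"
  proof (rule representationI)
    fix g h assume gh: "g \<in> carrier G" "h \<in> carrier G"
    then show "kronecker_mat (\<rho> (g \<otimes> h)) (\<sigma> (g \<otimes> h))
        = kronecker_mat (\<rho> g) (\<sigma> g) * kronecker_mat (\<rho> h) (\<sigma> h)"
      using D by (simp add: kronecker_mat_mult[of _ n n _ n _ m m _ m])
  qed (simp_all add: D kronecker_mat_carrier kronecker_mat_one)
  show "carrier_character G (\<lambda>g. kronecker_mat (\<rho> g) (\<sigma> g)) = carrier_character G \<rho> * carrier_character G \<sigma>"
    using D by (auto simp: fun_eq_iff carrier_character_def character_def trace_kronecker_mat[of _ n _ m])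
qed

text \<open>Supplies the unit of the algebra of characters: the constant 1, cut off outside the
  carrier.\<close>

lemma representation_trivial:
  shows "representation G 1 (\<lambda>g. 1\<^sub>m 1 :: 'f::field mat)"
    and "carrier_character G (\<lambda>g. 1\<^sub>m 1 :: 'f::field mat) = (\<lambda>g. if g \<in> carrier G then 1 else 0)"
proof -
  show "representation G 1 (\<lambda>g. 1\<^sub>m 1 :: 'f::field mat)"
    by (rule representationI) auto
  show "carrier_character G (\<lambda>g. 1\<^sub>m 1 :: 'f::field mat) = (\<lambda>g. if g \<in> carrier G then 1 else 0)"
    by (auto simp: fun_eq_iff carrier_character_def character_def sum_list_diag_mat[of _ 1 1])
qed

text \<open>Permutation matrices of left multiplication, with \<open>e\<close> enumerating the
  group. Diagonal entries of \<open>\<rho> g\<close> count fixed points, and only \<one> fixes any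
  element.\<close>

lemma regular_representation:
  assumes fin: "finite (carrier G)"
  obtains \<rho> :: "'a \<Rightarrow> 'f::field mat" where "representation G (Coset.order G) \<rho>"
    "\<And>g. g \<in> carrier G \<Longrightarrow> character \<rho> g = (if g = \<one> then of_nat (Coset.order G) else 0)"
proof -
  let ?N = "Coset.order G"
  obtain e where "bij_betw e {0..<?N} (carrier G)"
    using ex_bij_betw_nat_finite[OF fin] by (auto simp: Coset.order_def)
  then have e: "bij_betw e {..<?N} (carrier G)"
    by (simp add: atLeast0LessThan)
  have ec: "e i \<in> carrier G" if "i < ?N" for i
    using e that by (auto simp: bij_betw_def)
  have einj: "e i = e j \<longleftrightarrow> i = j" if "i < ?N" "j < ?N" for i j
    using e that by (auto simp: bij_betw_def inj_on_def)
  define \<rho> :: "'a \<Rightarrow> 'f mat" where "\<rho> g = mat ?N ?N (\<lambda>(i, j). if e i = g \<otimes> e j then 1 else 0)" for g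
  have carr: "\<rho> g \<in> carrier_mat ?N ?N" for g by (simp add: \<rho>_def)
  show thesis
  proof (rule that)
    show "representation G ?N \<rho>"
    proof (rule representationI)
      show "\<rho> \<one> = 1\<^sub>m ?N"
        by (rule eq_matI) (auto simp: \<rho>_def ec einj)
      fix g h assume gh: "g \<in> carrier G" "h \<in> carrier G"
      show "\<rho> (g \<otimes> h) = \<rho> g * \<rho> h"
      proof (rule eq_matI)
        fix i j assume "i < dim_row (\<rho> g * \<rho> h)" "j < dim_col (\<rho> g * \<rho> h)"
        then have ij: "i < ?N" "j < ?N" using carr[of g] carr[of h] by auto
        have "(\<rho> g * \<rho> h) $$ (i, j)
            = (\<Sum>l<?N. (if e i = g \<otimes> e l then 1 else 0) * (if e l = h \<otimes> e j then 1 else 0))"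
          using mat_mult_sum[OF carr carr ij] ij by (simp add: \<rho>_def)
        also have "\<dots> = (\<Sum>x\<in>carrier G. (if e i = g \<otimes> x then 1 else 0) * (if x = h \<otimes> e j then 1 else 0))"
          by (rule sum.reindex_bij_betw[OF e])
        also have "\<dots> = (\<Sum>x\<in>carrier G. if x = h \<otimes> e j then (if e i = g \<otimes> x then 1 else 0) else 0)"
          by (rule sum.cong) auto
        also have "\<dots> = (if e i = g \<otimes> (h \<otimes> e j) then 1 else 0)"
          using fin gh ec[OF ij(2)] by simp
        also have "\<dots> = \<rho> (g \<otimes> h) $$ (i, j)"
          using ij gh ec[OF ij(2)] by (simp add: \<rho>_def m_assoc)
        finally show "\<rho> (g \<otimes> h) $$ (i, j) = (\<rho> g * \<rho> h) $$ (i, j)" by simp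
      qed (auto simp: \<rho>_def)
    qed (auto simp: \<rho>_def)
    fix g assume g: "g \<in> carrier G"
    have "e i = g \<otimes> e i \<longleftrightarrow> g = \<one>" if "i < ?N" for i
      using ec[OF that] g by simp
    then show "character \<rho> g = (if g = \<one> then of_nat ?N else 0)"
      unfolding character_def sum_list_diag_mat[OF carr] by (simp add: \<rho>_def)
  qed
qed

end

section \<open>Irreducible characters as a basis of the functions on \<open>F\<close>-classes\<close>

lemma sum_fun_apply: "(\<Sum>i\<in>A. f i) x = (\<Sum>i\<in>A. f i x)"
  by (induction A rule: infinite_finite_induct) auto

text \<open>The classes are exactly the nonempty fibres of \<open>f\<close>, and a fibre determines
  its value. It serves both counts: irreducibles by their characters, group elements by their class
  indicators.\<close>

lemma card_quotient_eq_card_image: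
  assumes "equiv A r" and "\<And>x y. x \<in> A \<Longrightarrow> y \<in> A \<Longrightarrow> (x, y) \<in> r \<longleftrightarrow> f x = f y"
  shows "card (A // r) = card (f ` A)"
proof -
  let ?h = "\<lambda>z. {y \<in> A. f y = z}"
  have "r `` {x} = ?h (f x)" if "x \<in> A" for x
    using assms that equiv_type[OF assms(1)] by auto
  then have "A // r = ?h ` f ` A"
    by (auto simp: quotient_def)
  moreover have "inj_on ?h (f ` A)"
    by (auto simp: inj_on_def)
  ultimately show ?thesis
    by (simp add: card_image)
qed

definition class_indicator :: "('a \<times> 'a) set \<Rightarrow> 'a \<Rightarrow> 'a \<Rightarrow> 'f::field" where
  "class_indicator r x y = (if (x, y) \<in> r then 1 else 0)"

lemma class_indicator_eq_iff:
  assumes "equiv A r" and "x \<in> A" "y \<in> A"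
  shows "(class_indicator r x :: 'a \<Rightarrow> 'f::field) = class_indicator r y \<longleftrightarrow> (x, y) \<in> r"
proof
  assume eq: "(class_indicator r x :: 'a \<Rightarrow> 'f) = class_indicator r y"
  have "(y, y) \<in> r"
    using assms by (simp add: equiv_def refl_on_def)
  then show "(x, y) \<in> r"
    using fun_cong[OF eq, of y] by (simp add: class_indicator_def split: if_splits)
next
  assume "(x, y) \<in> r"
  then have "r `` {x} = r `` {y}"
    using equiv_class_eq[OF assms(1)] by blast
  then have "(x, z) \<in> r \<longleftrightarrow> (y, z) \<in> r" for z
    by blast
  then show "(class_indicator r x :: 'a \<Rightarrow> 'f) = class_indicator r y"
    by (simp add: class_indicator_def fun_eq_iff)
qed

text \<open>Evaluation at \<open>x\<close> acts as a coordinate functional: among the indicators it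
  singles out that of the class of \<open>x\<close>. Both independence and spanning rest on
  this.\<close>

lemma class_indicator_apply:
  assumes "equiv A r" and "w \<in> class_indicator r ` A" and "x \<in> A"
  shows "w x = (if w = class_indicator r x then 1 else 0 :: 'f::field)"
proof -
  obtain y where y: "y \<in> A" "w = class_indicator r y"
    using assms(2) by blast
  show ?thesis
    unfolding y(2) class_indicator_eq_iff[OF assms(1) y(1) assms(3)] by (simp add: class_indicator_def)
qed

lemma independent_class_indicators:
  assumes "equiv A r"
  shows "func.independent (class_indicator r ` A :: ('a \<Rightarrow> 'f::field) set)"
  unfolding func.independent_explicit_module
proof (intro allI impI)
  fix t and u :: "('a \<Rightarrow> 'f) \<Rightarrow> 'f" and v
  assume t: "finite t" "t \<subseteq> class_indicator r ` A"
    and 0: "(\<Sum>w\<in>t. (\<lambda>x. u w * w x)) = 0" and v: "v \<in> t"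
  obtain x where x: "x \<in> A" "v = class_indicator r x"
    using subsetD[OF t(2) v] by blast
  have "0 = (\<Sum>w\<in>t. u w * w x)"
    using fun_cong[OF 0, of x] unfolding sum_fun_apply by simp
  also have "\<dots> = (\<Sum>w\<in>t. if w = v then u w else 0)"
  proof (rule sum.cong)
    fix w assume "w \<in> t"
    then have "w \<in> class_indicator r ` A"
      using t(2) by (rule subsetD[rotated])
    from class_indicator_apply[OF assms this x(1)]
    show "u w * w x = (if w = v then u w else 0)"
      unfolding x(2) by simp
  qed simp
  also have "\<dots> = u v"
    using t(1) v by simp
  finally show "u v = 0" ..
qed

lemma in_span_class_indicators:
  fixes f :: "'a \<Rightarrow> 'f::field"
  assumes "equiv A r" and "finite A"
    and 0: "\<And>x. x \<notin> A \<Longrightarrow> f x = 0" and const: "\<And>x y. (x, y) \<in> r \<Longrightarrow> f x = f y"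
  shows "f \<in> func.span (class_indicator r ` A)" (is "f \<in> func.span ?T")
proof -
  \<comment> \<open>A chosen representative of the class with indicator \<open>v\<close>; the
    coefficient of \<open>v\<close> in the expansion of \<open>f\<close> is
    \<open>f (p v)\<close>.\<close>
  define p where "p v = (SOME x. x \<in> A \<and> v = (class_indicator r x :: 'a \<Rightarrow> 'f))" for v
  have p: "p v \<in> A" "v = class_indicator r (p v)" if "v \<in> ?T" for v
  proof -
    have "\<exists>x. x \<in> A \<and> v = class_indicator r x"
      using that by blast
    then have "p v \<in> A \<and> v = class_indicator r (p v)"
      unfolding p_def by (rule someI_ex)
    then show "p v \<in> A" "v = class_indicator r (p v)"
      by simp_all
  qed
  have "f x = (\<Sum>v\<in>?T. f (p v) * v x)" for x
  proof (cases "x \<in> A")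
    case True
    let ?x = "class_indicator r x :: 'a \<Rightarrow> 'f"
    have x: "?x \<in> ?T" using True by simp
    have "(\<Sum>v\<in>?T. f (p v) * v x) = (\<Sum>v\<in>?T. if v = ?x then f (p v) else 0)"
    proof (rule sum.cong)
      fix v assume "v \<in> ?T"
      from class_indicator_apply[OF assms(1) this True]
      show "f (p v) * v x = (if v = ?x then f (p v) else 0)"
        by simp
    qed simp
    also have "\<dots> = f (p ?x)"
      using x assms(2) by (simp only: sum.delta finite_imageI if_True)
    also have "(x, p ?x) \<in> r"
      using p[OF x] class_indicator_eq_iff[OF assms(1) True p(1)[OF x]] by blast
    then have "f (p ?x) = f x"
      using const by metis
    finally show ?thesis ..
  next
    case False
    have "(\<Sum>v\<in>?T. f (p v) * v x) = 0"
    proof (rule sum.neutral, rule ballI)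
      fix v assume "v \<in> ?T"
      then obtain y where "v = class_indicator r y"
        by blast
      then show "f (p v) * v x = 0"
        using False equiv_type[OF assms(1)] by (auto simp: class_indicator_def)
    qed
    then show ?thesis using 0[OF False] by simp
  qed
  then have "f = (\<Sum>v\<in>?T. (\<lambda>x. f (p v) * v x))"
    unfolding fun_eq_iff sum_fun_apply by blast
  also have "\<dots> \<in> func.span ?T"
    by (intro func.span_sum func.span_scale func.span_base)
  finally show ?thesis .
qed

section \<open>The pairing functional and independence of irreducible characters\<close>

context group
begin

text \<open>The trace of \<sigma> is expanded into diagonal entries, each of which is orthogonal to
  the corner entry of \<rho>. That entry exists because irreducible representations have positive
  degree.\<close>

lemma pairing_inequivalent:
  fixes \<rho> \<sigma> :: "'a \<Rightarrow> 'f::field mat"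
  assumes irr: "irreducible_representation G n \<rho>" "irreducible_representation G m \<sigma>"
    and neq: "\<not> equivalent_representations G \<sigma> \<rho>"
  shows "(\<Sum>g\<in>carrier G. \<rho> (inv g) $$ (0, 0) * carrier_character G \<sigma> g) = 0"
proof -
  have n: "0 < n" and \<sigma>: "\<And>g. g \<in> carrier G \<Longrightarrow> \<sigma> g \<in> carrier_mat m m"
    using irr by (auto simp: irreducible_representation_def representation_carrier_mat)
  have "(\<Sum>g\<in>carrier G. \<rho> (inv g) $$ (0, 0) * carrier_character G \<sigma> g)
      = (\<Sum>g\<in>carrier G. \<Sum>i<m. \<sigma> g $$ (i, i) * \<rho> (inv g) $$ (0, 0))"
    using \<sigma> by (intro sum.cong refl)
      (simp add: carrier_character_def character_def sum_list_diag_mat[of _ m m] sum_distrib_left mult.commute)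
  also have "\<dots> = (\<Sum>i<m. \<Sum>g\<in>carrier G. \<sigma> g $$ (i, i) * \<rho> (inv g) $$ (0, 0))"
    by (rule sum.swap)
  also have "\<dots> = 0"
    using schur_orthogonality[OF irr neq] n by simp
  finally show ?thesis .
qed

lemma pairing_self:
  fixes \<rho> :: "'a \<Rightarrow> 'f::field mat"
  assumes fin: "finite (carrier G)" and ord: "of_nat (Coset.order G) \<noteq> (0::'f)"
    and irr: "irreducible_representation G n \<rho>"
  shows "(\<Sum>g\<in>carrier G. \<rho> (inv g) $$ (0, 0) * carrier_character G \<rho> g) \<noteq> 0"
proof
  define \<phi> where "\<phi> f = (\<Sum>g\<in>carrier G. \<rho> (inv g) $$ (0, 0) * f g)" for f
  assume "(\<Sum>g\<in>carrier G. \<rho> (inv g) $$ (0, 0) * carrier_character G \<rho> g) = 0"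
  then have self: "\<phi> (carrier_character G \<rho>) = 0" by (simp add: \<phi>_def)
  have irreds: "\<phi> f = 0" if f: "f \<in> carrier_character G ` irreducibles G" for f
  proof -
    obtain m \<sigma> where \<sigma>: "irreducible_representation G m \<sigma>" "f = carrier_character G \<sigma>"
      using f by (auto simp: irreducibles_def)
    show ?thesis
    \<comment> \<open>Irreducibles equivalent to \<rho> share its character and fall under the
      assumption; the others are killed by orthogonality.\<close>
    proof (cases "equivalent_representations G \<sigma> \<rho>")
      case True
      then have "f = carrier_character G \<rho>"
        using \<sigma>(2) equivalent_representations_character[OF True]
        by (auto simp: fun_eq_iff carrier_character_def)
      then show ?thesis using self by simp
    next
      case False
      then show ?thesis
        using pairing_inequivalent[OF irr \<sigma>(1)] \<sigma>(2) by (simp add: \<phi>_def)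
    qed
  qed
  \<comment> \<open>The kernel of \<phi> is a subspace, so vanishing passes from irreducible
    characters to their span, which contains the regular character.\<close>
  have "func.subspace {f. \<phi> f = 0}"
  proof -
    have "\<phi> (f + h) = \<phi> f + \<phi> h" for f h
      by (simp add: \<phi>_def distrib_left sum.distrib)
    moreover have "\<phi> (\<lambda>x. c * f x) = c * \<phi> f" for c f
      by (simp add: \<phi>_def sum_distrib_left mult.left_commute)
    moreover have "\<phi> 0 = 0"
      by (simp add: \<phi>_def)
    ultimately show ?thesis
      by (simp only: func.subspace_def mem_Collect_eq) simp
  qed
  then have span: "\<phi> f = 0" if "f \<in> func.span (carrier_character G ` irreducibles G)" for f
    using func.span_induct[OF that] irreds by blast
  obtain \<tau> :: "'a \<Rightarrow> 'f mat" where \<tau>: "representation G (Coset.order G) \<tau>"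
    "\<And>g. g \<in> carrier G \<Longrightarrow> character \<tau> g = (if g = \<one> then of_nat (Coset.order G) else 0)"
    using regular_representation[OF fin] by blast
  have "\<phi> (carrier_character G \<tau>)
      = (\<Sum>g\<in>carrier G. if g = \<one> then \<rho> (inv g) $$ (0, 0) * of_nat (Coset.order G) else 0)"
    unfolding \<phi>_def using \<tau>(2) by (intro sum.cong) (auto simp: carrier_character_def)
  \<comment> \<open>Only \<one> contributes, where the corner entry is 1. The trace of \<rho> in
    place of this entry would contribute a factor \<open>n\<close>, which may be zero in the
    field.\<close>
  also have "\<dots> = of_nat (Coset.order G)"
    using fin irr representationD(2)[of n \<rho>] by (simp add: irreducible_representation_def)
  finally show False
    using span[OF carrier_character_in_span_irreducibles[OF \<tau>(1)]] ord by simp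
qed

text \<open>Applying the functional \<phi> of one irreducible \<rho> to a linear relation leaves
  only the coefficient of its own character, multiplied by a nonzero scalar.\<close>

lemma independent_irreducible_characters:
  assumes fin: "finite (carrier G)" and ord: "of_nat (Coset.order G) \<noteq> (0::'f::field)"
  shows "func.independent (carrier_character G ` irreducibles G :: ('a \<Rightarrow> 'f) set)"
  unfolding func.independent_explicit_module
proof (intro allI impI)
  fix t :: "('a \<Rightarrow> 'f) set" and u :: "('a \<Rightarrow> 'f) \<Rightarrow> 'f" and v
  assume t: "finite t" "t \<subseteq> carrier_character G ` irreducibles G"
    and 0: "(\<Sum>w\<in>t. (\<lambda>x. u w * w x)) = 0" and v: "v \<in> t"
  obtain n \<rho> where \<rho>: "irreducible_representation G n \<rho>" "v = carrier_character G \<rho>"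
    using t v by (auto simp: irreducibles_def)
  define \<phi> where "\<phi> f = (\<Sum>g\<in>carrier G. \<rho> (inv g) $$ (0, 0) * f g)" for f
  have \<phi>0: "\<phi> w = 0" if w: "w \<in> t" "w \<noteq> v" for w
  proof -
    obtain m \<sigma> where \<sigma>: "irreducible_representation G m \<sigma>" "w = carrier_character G \<sigma>"
      using t w by (auto simp: irreducibles_def)
    \<comment> \<open>Equivalent representations would have the same character, while
      \<open>w\<close> and \<open>v\<close> differ.\<close>
    have "\<not> equivalent_representations G \<sigma> \<rho>"
      using equivalent_representations_character[of G \<sigma> \<rho>] w(2) \<rho>(2) \<sigma>(2)
      by (auto simp: fun_eq_iff carrier_character_def split: if_splits)
    then show ?thesis
      using pairing_inequivalent[OF \<rho>(1) \<sigma>(1)] \<sigma>(2) by (simp add: \<phi>_def)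
  qed
  have "(\<Sum>w\<in>t. u w * w g) = 0" for g
    using fun_cong[OF 0, of g] by (simp add: sum_fun_apply)
  then have "0 = (\<Sum>g\<in>carrier G. \<rho> (inv g) $$ (0, 0) * (\<Sum>w\<in>t. u w * w g))"
    by simp
  also have "\<dots> = (\<Sum>w\<in>t. u w * \<phi> w)"
    unfolding \<phi>_def sum_distrib_left by (subst sum.swap) (simp add: mult.left_commute)
  also have "\<dots> = (\<Sum>w\<in>{v}. u w * \<phi> w)"
    using t v \<phi>0 by (intro sum.mono_neutral_right) auto
  finally show "u v = 0"
    using pairing_self[OF fin ord \<rho>(1)] \<rho>(2) by (simp add: \<phi>_def)
qed

section \<open>The algebra spanned by the irreducible characters\<close>

lemma span_irreducible_characters_mult:
  fixes f h :: "'a \<Rightarrow> 'f::field"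
  assumes f: "f \<in> func.span (carrier_character G ` irreducibles G)"
    and h: "h \<in> func.span (carrier_character G ` irreducibles G)"
  shows "f * h \<in> func.span (carrier_character G ` irreducibles G)" (is "_ \<in> func.span ?I")
proof -
  have irr: "\<chi> * \<psi> \<in> func.span ?I" if \<chi>\<psi>: "\<chi> \<in> ?I" "\<psi> \<in> ?I" for \<chi> \<psi>
  proof -
    obtain \<rho> \<sigma> n m where \<rho>: "representation G n \<rho>" "\<chi> = carrier_character G \<rho>"
      and \<sigma>: "representation G m \<sigma>" "\<psi> = carrier_character G \<sigma>"
      using \<chi>\<psi> by (auto simp: irreducibles_def irreducible_representation_def)
    show ?thesis
      unfolding \<rho>(2) \<sigma>(2) representation_tensor(2)[OF \<rho>(1) \<sigma>(1), symmetric]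
      by (rule carrier_character_in_span_irreducibles[OF representation_tensor(1)[OF \<rho>(1) \<sigma>(1)]])
  qed
  \<comment> \<open>Linearity in the left factor. It is used twice: with \<open>w\<close> an
    irreducible character, to let the other factor range over the span, and then with
    \<open>w = h\<close>.\<close>
  have sub: "func.subspace {k. k * w \<in> func.span ?I}" for w
    unfolding func.subspace_def
  proof (intro conjI ballI allI CollectI)
    show "0 * w \<in> func.span ?I"
      unfolding mult_zero_left by (rule func.span_zero)
  next
    fix k l assume "k \<in> {k. k * w \<in> func.span ?I}" "l \<in> {k. k * w \<in> func.span ?I}"
    then show "(k + l) * w \<in> func.span ?I"
      unfolding distrib_right mem_Collect_eq by (rule func.span_add)
  next
    fix c k assume "k \<in> {k. k * w \<in> func.span ?I}"
    moreover have "(\<lambda>x. c * k x) * w = (\<lambda>x. c * (k * w) x)"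
      by (simp add: fun_eq_iff mult.assoc)
    ultimately show "(\<lambda>x. c * k x) * w \<in> func.span ?I"
      by (metis func.span_scale mem_Collect_eq)
  qed
  have "\<chi> * h \<in> func.span ?I" if \<chi>: "\<chi> \<in> ?I" for \<chi>
    unfolding mult.commute[of \<chi>]
    by (rule func.span_induct[OF h sub]) (rule irr[OF _ \<chi>])
  then show ?thesis
    by (rule func.span_induct[OF f sub])
qed

text \<open>Both are linear conditions on \<open>f\<close>, so it is enough that irreducible
  characters satisfy them.\<close>

lemma span_irreducible_characters_F_conjugate:
  fixes f :: "'a \<Rightarrow> 'f::field"
  assumes f: "f \<in> func.span (carrier_character G ` irreducibles G)"
  shows "x \<notin> carrier G \<Longrightarrow> f x = 0"
    and "(x, y) \<in> F_conjugacy TYPE('f) G \<Longrightarrow> f x = f y"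
proof -
  have "func.subspace {f. f x = 0}"
    by (auto simp: func.subspace_def)
  then show "f x = 0" if "x \<notin> carrier G"
    by (rule func.span_induct[OF f]) (use that in \<open>auto simp: carrier_character_def\<close>)
  have "func.subspace {f. f x = f y}"
    by (auto simp: func.subspace_def)
  then show "f x = f y" if "(x, y) \<in> F_conjugacy TYPE('f) G"
    by (rule func.span_induct[OF f])
      (use that in \<open>auto simp: carrier_character_def F_conjugacy_def F_conjugate_def irreducibles_def
        irreducible_representation_def\<close>)
qed

text \<open>As in Lagrange interpolation, \<open>f\<close> is a product with one factor for each
  \<open>y\<close> in \<open>Y\<close>, equal to 1 at \<open>x\<close> and 0 at \<open>y\<close>.
  The empty product is the trivial character.\<close>

lemma span_irreducible_characters_separate:
  assumes x: "x \<in> carrier G" and "finite Y"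
    and "Y \<subseteq> carrier G" and "\<And>y. y \<in> Y \<Longrightarrow> (x, y) \<notin> F_conjugacy TYPE('f::field) G"
  shows "\<exists>f \<in> func.span (carrier_character G ` irreducibles G :: ('a \<Rightarrow> 'f) set).
    f x = 1 \<and> (\<forall>y\<in>Y. f y = 0)"
  using assms(2-)
proof (induction Y rule: finite_induct)
  case empty
  have "(\<lambda>g. if g \<in> carrier G then 1 else 0)
      \<in> func.span (carrier_character G ` irreducibles G :: ('a \<Rightarrow> 'f) set)"
    by (rule carrier_character_in_span_irreducibles[OF representation_trivial(1),
          unfolded representation_trivial(2)])
  then show ?case
    using x by (intro bexI[of _ "\<lambda>g. if g \<in> carrier G then 1 else 0"]) simp_all
next
  case (insert y Y)
  let ?S = "func.span (carrier_character G ` irreducibles G :: ('a \<Rightarrow> 'f) set)"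
  obtain f where f: "f \<in> ?S" "f x = 1" "\<forall>y\<in>Y. f y = 0"
    using insert.IH insert.prems by blast
  define one :: "'a \<Rightarrow> 'f" where "one = (\<lambda>g. if g \<in> carrier G then 1 else 0)"
  have one: "one \<in> ?S"
    unfolding one_def by (rule carrier_character_in_span_irreducibles[OF representation_trivial(1),
          unfolded representation_trivial(2)])
  have y: "y \<in> carrier G" and xy: "(x, y) \<notin> F_conjugacy TYPE('f) G"
    using insert.prems by simp_all
  then obtain n and \<rho> :: "'a \<Rightarrow> 'f mat"
    where \<rho>: "representation G n \<rho>" "character \<rho> x \<noteq> character \<rho> y"
    using x unfolding F_conjugacy_def F_conjugate_def by blast
  define \<chi> where "\<chi> = carrier_character G \<rho>"
  have \<chi>: "\<chi> \<in> ?S"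
    unfolding \<chi>_def by (rule carrier_character_in_span_irreducibles[OF \<rho>(1)])
  have \<chi>xy: "\<chi> x \<noteq> \<chi> y"
    using \<rho>(2) x y by (simp add: \<chi>_def carrier_character_def)
  \<comment> \<open>A character that distinguishes \<open>x\<close> from \<open>y\<close>, shifted
    and rescaled to take the values 1 and 0 there.\<close>
  define h where "h = (\<lambda>g. inverse (\<chi> x - \<chi> y) * (\<chi> - (\<lambda>g. \<chi> y * one g)) g)"
  have h: "h \<in> ?S"
    unfolding h_def using \<chi> one by (intro func.span_scale func.span_diff)
  have "h x = 1" "h y = 0"
    using x y \<chi>xy by (simp_all add: h_def one_def)
  then have "(f * h) x = 1" "\<forall>z\<in>insert y Y. (f * h) z = 0"
    using f(2,3) by simp_all
  then show ?case
    using span_irreducible_characters_mult[OF f(1) h] by (intro bexI[of _ "f * h"] conjI)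
qed

text \<open>Irreducible characters and class indicators are both independent, and each family lies
  in the span of the other; the exchange bound applies in both directions.\<close>

lemma card_irreducible_characters:
  assumes fin: "finite (carrier G)" and ord: "of_nat (Coset.order G) \<noteq> (0::'f::field)"
  shows "card (carrier_character G ` irreducibles G :: ('a \<Rightarrow> 'f) set)
    = card (carrier G // F_conjugacy TYPE('f) G)"
proof -
  let ?S = "carrier_character G ` irreducibles G :: ('a \<Rightarrow> 'f) set"
  let ?r = "F_conjugacy TYPE('f) G"
  let ?T = "class_indicator ?r ` carrier G :: ('a \<Rightarrow> 'f) set"
  note eq = equiv_F_conjugacy[of G "TYPE('f)"]
  have finT: "finite ?T"
    using fin by (rule finite_imageI)
  have "?S \<subseteq> func.span ?T"
  proof
    fix \<chi> assume "\<chi> \<in> ?S"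
    then have "\<chi> \<in> func.span ?S"
      by (rule func.span_base)
    from span_irreducible_characters_F_conjugate[OF this]
    show "\<chi> \<in> func.span ?T"
      by (rule in_span_class_indicators[OF eq fin])
  qed
  from func.independent_span_bound[OF finT independent_irreducible_characters[OF fin ord] this]
  \<comment> \<open>Finiteness of the set of irreducible characters comes out of this first bound
    and is required for the second.\<close>
  have ST: "finite ?S" "card ?S \<le> card ?T"
    by simp_all
  have "?T \<subseteq> func.span ?S"
  proof
    fix v assume "v \<in> ?T"
    then obtain x where x: "x \<in> carrier G" "v = class_indicator ?r x"
      by blast
    \<comment> \<open>The union of all other classes. An \<open>f\<close> in the span that is 1 at
      \<open>x\<close> and 0 on \<open>?Y\<close> is 1 on the whole class of \<open>x\<close> and
      vanishes off the carrier, so it is the class indicator.\<close>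
    let ?Y = "{y \<in> carrier G. (x, y) \<notin> ?r}"
    have "\<exists>f \<in> func.span ?S. f x = 1 \<and> (\<forall>y\<in>?Y. f y = 0)"
      using fin by (intro span_irreducible_characters_separate[OF x(1)]) simp_all
    then obtain f where f: "f \<in> func.span ?S" "f x = 1" "\<forall>y\<in>?Y. f y = 0"
      by blast
    note f' = span_irreducible_characters_F_conjugate[OF f(1)]
    have "f y = class_indicator ?r x y" for y
    proof (cases "(x, y) \<in> ?r")
      case True
      then show ?thesis
        using f'(2)[OF True] f(2) by (simp add: class_indicator_def)
    next
      case False
      then show ?thesis
        using f'(1)[of y] f(3) by (cases "y \<in> carrier G") (simp_all add: class_indicator_def)
    qed
    then have vf: "v = f"
      unfolding x(2) by (simp add: fun_eq_iff)
    show "v \<in> func.span ?S"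
      unfolding vf by (rule f(1))
  qed
  then have "card ?T \<le> card ?S"
    using func.independent_span_bound[OF ST(1) independent_class_indicators[OF eq]] by blast
  moreover have "card (carrier G // ?r) = card ?T"
    by (rule card_quotient_eq_card_image[OF eq]) (simp only: class_indicator_eq_iff[OF eq])
  ultimately show ?thesis
    using ST(2) by linarith
qed

end

theorem theorem3p1p2:
  fixes G :: "('g, 'b) monoid_scheme"
  assumes "group G" and "finite (carrier G)"
    and "CHAR('f::field) = 0 \<or> coprime CHAR('f) (Coset.order G)"
  shows "card (irreducibles G // (irreducible_equivalence G :: (('g \<Rightarrow> 'f mat) \<times> ('g \<Rightarrow> 'f mat)) set))
       = card (carrier G // F_conjugacy TYPE('f) G)"
proof -
  interpret group G by fact
  have "Coset.order G > 0"
    using assms(2) by (simp add: order_gt_0_iff_finite)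
  moreover have "CHAR('f) \<noteq> 1"
    by simp
  \<comment> \<open>If the characteristic divided the group order, it would be 0 with order 0, or
    coprime to one of its own multiples and hence 1. Both are excluded.\<close>
  ultimately have ord: "of_nat (Coset.order G) \<noteq> (0::'f)"
    using assms(3) by (auto simp: of_nat_eq_0_iff_char_dvd coprime_absorb_left)
  \<comment> \<open>Characters classify irreducibles, so counting equivalence classes amounts to
    counting characters.\<close>
  have "(\<rho>, \<sigma>) \<in> irreducible_equivalence G \<longleftrightarrow> carrier_character G \<rho> = carrier_character G \<sigma>"
    if irreds: "\<rho> \<in> irreducibles G" "\<sigma> \<in> irreducibles G" for \<rho> \<sigma> :: "'g \<Rightarrow> 'f mat"
  proof
    assume "(\<rho>, \<sigma>) \<in> irreducible_equivalence G"
    then show "carrier_character G \<rho> = carrier_character G \<sigma>"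
      by (auto simp: irreducible_equivalence_def fun_eq_iff carrier_character_def
          equivalent_representations_character)
  next
    assume eq: "carrier_character G \<rho> = carrier_character G \<sigma>"
    obtain n m where irr: "irreducible_representation G n \<rho>" "irreducible_representation G m \<sigma>"
      using irreds by (auto simp: irreducibles_def)
    \<comment> \<open>Were they inequivalent, the functional of \<sigma> would vanish on the
      character of \<rho>, which is also the character of \<sigma>, where it is nonzero.\<close>
    show "(\<rho>, \<sigma>) \<in> irreducible_equivalence G"
      using pairing_inequivalent[OF irr(2,1)] pairing_self[OF assms(2) ord irr(2)] eq irreds
      by (auto simp: irreducible_equivalence_def)
  qed
  note card_quotient_eq_card_image[OF equiv_irreducible_equivalence this]
  also note card_irreducible_characters[OF assms(2) ord]
  finally show ?thesis .
qed

end
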